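(* Let $1<\alpha\le2$, $d,n\in\mathbb{N}$, let $t_1,\dots,t_n\in\mathbb{R}^d$ be distinct, and let $X(t)=\int_{\mathbb{R}^d}f(t-x)\,M(dx)$, $t\in\mathbb{R}^d$, be a moving average random field, where $M$ is an $\alpha$-stable random measure on $\mathbb{R}^d$ with Lebesgue control measure and $f:\mathbb{R}^d\to\mathbb{R}$ is measurable with $\int_{\mathbb{R}^d}|f(x)|^\alpha dx<\infty$. If the covariation function $\kappa$ of $X$ is positive definite and continuous, then the Covariation Orthogonal Linear (COL) predictor based on $X(t_1),\dots,X(t_n)$ is continuous.
   Context: Stable laws: for $1<\alpha\le2$, $S_\alpha(\sigma,\beta,\mu)$ is the law with characteristic function $\theta\mapsto\exp\{-\sigma^\alpha|\theta|^\alpha(1-i\beta\,\mathrm{sign}(\theta)\tan(\pi\alpha/2))+i\mu\theta\}$. Random measure: an $\alpha$-stable random measure $M$ with control measure $m$ (here Lebesgue measure) and measurable skewness function $\beta$ with values in $[-1,1]$ is an independently scattered (values on disjoint sets are independent), a.s. $\sigma$-additive map from the sets of finite $m$-measure to random variables with $M(A)\sim S_\alpha\big(m(A)^{1/\alpha},\int_A\beta\,dm/m(A),0\big)$; $\int g\,dM$ is defined for $g\in L^\alpha(m)$ by approximation with simple functions. Covariation: write $a^{<p>}=|a|^p\,\mathrm{sign}(a)$. For $U=\int g\,dM$, $V=\int h\,dM$, $[U,V]_\alpha=\int g\,h^{<\alpha-1>}dm$. For the moving average, $[X(t+h),X(t)]_\alpha$ does not depend on $t$, and the covariation function is the function of one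 variable $$\kappa(h)=[X(h),X(0)]_\alpha=\int_{\mathbb{R}^d}f(h-x)f(-x)^{<\alpha-1>}dx,\quad h\in\mathbb{R}^d.$$ Positive definite means $\sum_{i,j=1}^k\kappa(s_i-s_j)z_iz_j>0$ for all $k\in\mathbb{N}$, distinct $s_1,\dots,s_k\in\mathbb{R}^d$ and $(z_1,\dots,z_k)\in\mathbb{R}^k\setminus\{0\}$. COL predictor: for $t_0\in\mathbb{R}^d$, the COL predictor of $X(t_0)$ is $\widehat{X(t_0)}=\sum_{i=1}^n\lambda_iX(t_i)$ where $(\lambda_1,\dots,\lambda_n)$ solves the linear system $[X(t_0),X(t_j)]_\alpha-\sum_{i=1}^n\lambda_i[X(t_i),X(t_j)]_\alpha=0$, $j=1,\dots,n$, i.e. $\sum_{i=1}^n\kappa(t_i-t_j)\lambda_i=\kappa(t_0-t_j)$, $j=1,\dots,n$. Continuous: the weights, considered as functions $\lambda_i:\mathbb{R}^d\to\mathbb{R}$, $t\mapsto\lambda_i(t)$, of the prediction location, are continuous on $\mathbb{R}^d$. *)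

theory Defs
  imports "HOL-Probability.Probability"
begin

text \<open>The characteristic function of \<open>S\<^sub>\<alpha>(\<sigma>, \<beta>, \<mu>)\<close>, \<open>1 < \<alpha> \<le> 2\<close>. Since \<open>0 powr \<alpha> = 0\<close>,
  the law with \<open>\<sigma> = 0\<close> is the Dirac law at \<open>\<mu>\<close>.\<close>

definition stable_char :: "real \<Rightarrow> real \<Rightarrow> real \<Rightarrow> real \<Rightarrow> real \<Rightarrow> complex" where
  "stable_char \<alpha> \<sigma> \<beta> \<mu> \<theta> =
     exp (- complex_of_real (\<sigma> powr \<alpha> * \<bar>\<theta>\<bar> powr \<alpha>)
            * (1 - \<i> * complex_of_real (\<beta> * sgn \<theta> * tan (pi * \<alpha> / 2)))
          + \<i> * complex_of_real (\<mu> * \<theta>))"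

definition has_stable_law :: "'w measure \<Rightarrow> ('w \<Rightarrow> real) \<Rightarrow> real \<Rightarrow> real \<Rightarrow> real \<Rightarrow> real \<Rightarrow> bool" where
  "has_stable_law P Y \<alpha> \<sigma> \<beta> \<mu> \<longleftrightarrow>
     Y \<in> borel_measurable P \<and> (\<forall>\<theta>. char (distr P borel Y) \<theta> = stable_char \<alpha> \<sigma> \<beta> \<mu> \<theta>)"

definition finite_measure_sets :: "'a measure \<Rightarrow> 'a set set" where
  "finite_measure_sets m = {A \<in> sets m. emeasure m A < \<infinity>}"

text \<open>For a null set \<open>A\<close> the skewness quotient reads \<open>0 / 0 = 0\<close>; it is irrelevant there,
  because the scale is \<open>0\<close>.\<close>

definition stable_random_measure ::
    "'w measure \<Rightarrow> ('a set \<Rightarrow> 'w \<Rightarrow> real) \<Rightarrow> real \<Rightarrow> 'a measure \<Rightarrow> ('a \<Rightarrow> real) \<Rightarrow> bool" where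
  "stable_random_measure P M \<alpha> m \<beta> \<longleftrightarrow>
     \<beta> \<in> borel_measurable m \<and> (\<forall>x. \<beta> x \<in> {-1..1}) \<and>
     (\<forall>A \<in> finite_measure_sets m.
        has_stable_law P (M A) \<alpha> (measure m A powr (1 / \<alpha>)) ((LINT x:A|m. \<beta> x) / measure m A) 0) \<and>
     (\<forall>(A :: nat \<Rightarrow> 'a set) k.
        disjoint_family_on A {..<k} \<and> (\<forall>i<k. A i \<in> finite_measure_sets m) \<longrightarrow>
        prob_space.indep_vars P (\<lambda>_. borel) (\<lambda>i. M (A i)) {..<k}) \<and>
     (\<forall>A :: nat \<Rightarrow> 'a set.
        disjoint_family A \<and> range A \<subseteq> finite_measure_sets m \<and> (\<Union>i. A i) \<in> finite_measure_sets m \<longrightarrow>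
        (AE \<omega> in P. (\<lambda>i. M (A i) \<omega>) sums M (\<Union>i. A i) \<omega>))"

text \<open>The integral of a simple function with respect to a random measure. The value \<open>0\<close> is left
  out of the sum, as its level set may have infinite control measure, where \<open>M\<close> is unspecified.\<close>

definition simple_stable_integral ::
    "('a set \<Rightarrow> 'w \<Rightarrow> real) \<Rightarrow> 'a measure \<Rightarrow> ('a \<Rightarrow> real) \<Rightarrow> 'w \<Rightarrow> real" where
  "simple_stable_integral M m g \<omega> = (\<Sum>y \<in> g ` space m - {0}. y * M {x \<in> space m. g x = y} \<omega>)"

definition L_alpha :: "real \<Rightarrow> 'a measure \<Rightarrow> ('a \<Rightarrow> real) set" where
  "L_alpha \<alpha> m = {g \<in> borel_measurable m. integrable m (\<lambda>x. \<bar>g x\<bar> powr \<alpha>)}"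

definition tendsto_in_prob :: "'w measure \<Rightarrow> (nat \<Rightarrow> 'w \<Rightarrow> real) \<Rightarrow> ('w \<Rightarrow> real) \<Rightarrow> bool" where
  "tendsto_in_prob P Y Z \<longleftrightarrow>
     (\<forall>\<epsilon>>0. (\<lambda>k. measure P {\<omega> \<in> space P. \<bar>Y k \<omega> - Z \<omega>\<bar> > \<epsilon>}) \<longlonglongrightarrow> 0)"

text \<open>\<open>has_stable_integral P M \<alpha> m g Y\<close>: the random variable \<open>Y\<close> is (a version of) \<open>\<integral>g dM\<close>, which
  is determined only up to almost sure equality; hence a relation and not a function.\<close>

definition has_stable_integral ::
    "'w measure \<Rightarrow> ('a set \<Rightarrow> 'w \<Rightarrow> real) \<Rightarrow> real \<Rightarrow> 'a measure \<Rightarrow> ('a \<Rightarrow> real) \<Rightarrow> ('w \<Rightarrow> real) \<Rightarrow> bool" where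
  "has_stable_integral P M \<alpha> m g Y \<longleftrightarrow>
     g \<in> L_alpha \<alpha> m \<and> Y \<in> borel_measurable P \<and>
     (\<exists>s. (\<forall>k. Bochner_Integration.simple_bochner_integrable m (s k)) \<and>
          (\<lambda>k. LINT x|m. \<bar>s k x - g x\<bar> powr \<alpha>) \<longlonglongrightarrow> 0 \<and>
          tendsto_in_prob P (\<lambda>k. simple_stable_integral M m (s k)) Y)"

definition moving_average ::
    "'w measure \<Rightarrow> ('v::euclidean_space set \<Rightarrow> 'w \<Rightarrow> real) \<Rightarrow> real \<Rightarrow> ('v \<Rightarrow> real) \<Rightarrow> ('v \<Rightarrow> 'w \<Rightarrow> real) \<Rightarrow> bool" where
  "moving_average P M \<alpha> f X \<longleftrightarrow> (\<forall>t. has_stable_integral P M \<alpha> lborel (\<lambda>x. f (t - x)) (X t))"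

definition signed_powr :: "real \<Rightarrow> real \<Rightarrow> real" where
  "signed_powr a p = \<bar>a\<bar> powr p * sgn a"

text \<open>The covariation \<open>[U, V]\<^sub>\<alpha>\<close> of two integrals with respect to \<open>M\<close>. The integrands are determined
  up to null sets by \<open>U\<close> and \<open>V\<close>, so the description below picks out a unique number.\<close>

definition covariation ::
    "'w measure \<Rightarrow> ('a set \<Rightarrow> 'w \<Rightarrow> real) \<Rightarrow> real \<Rightarrow> 'a measure \<Rightarrow> ('w \<Rightarrow> real) \<Rightarrow> ('w \<Rightarrow> real) \<Rightarrow> real" where
  "covariation P M \<alpha> m U V =
     (THE c. \<exists>g h. has_stable_integral P M \<alpha> m g U \<and> has_stable_integral P M \<alpha> m h V \<and>
                   c = (LINT x|m. g x * signed_powr (h x) (\<alpha> - 1)))"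

definition covariation_function ::
    "'w measure \<Rightarrow> ('v::euclidean_space set \<Rightarrow> 'w \<Rightarrow> real) \<Rightarrow> real \<Rightarrow> ('v \<Rightarrow> 'w \<Rightarrow> real) \<Rightarrow> 'v \<Rightarrow> real" where
  "covariation_function P M \<alpha> X h = covariation P M \<alpha> lborel (X h) (X 0)"

text \<open>Strict positivity, and no symmetry of \<open>\<kappa>\<close> is required.\<close>

definition positive_definite :: "('v::real_vector \<Rightarrow> real) \<Rightarrow> bool" where
  "positive_definite \<kappa> \<longleftrightarrow>
     (\<forall>(k::nat) (s :: nat \<Rightarrow> 'v) (z :: nat \<Rightarrow> real).
        inj_on s {1..k} \<and> (\<exists>i\<in>{1..k}. z i \<noteq> 0) \<longrightarrow>
        (\<Sum>i=1..k. \<Sum>j=1..k. \<kappa> (s i - s j) * z i * z j) > 0)"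

text \<open>\<open>w\<close> is a vector of weights of a COL predictor \<open>\<Sum>i. w i * X (t i)\<close> of \<open>X t0\<close>.\<close>

definition COL_weights ::
    "'w measure \<Rightarrow> ('v::euclidean_space set \<Rightarrow> 'w \<Rightarrow> real) \<Rightarrow> real \<Rightarrow> ('v \<Rightarrow> 'w \<Rightarrow> real)
      \<Rightarrow> ('n::finite \<Rightarrow> 'v) \<Rightarrow> 'v \<Rightarrow> ('n \<Rightarrow> real) \<Rightarrow> bool" where
  "COL_weights P M \<alpha> X t t0 w \<longleftrightarrow>
     (\<forall>j. covariation P M \<alpha> lborel (X t0) (X (t j))
            - (\<Sum>i\<in>UNIV. w i * covariation P M \<alpha> lborel (X (t i)) (X (t j))) = 0)"

end

theory Submission
  imports Defs
begin

text \<open>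
  The weights at \<open>t0\<close> solve a linear system whose matrix \<open>\<kappa> (t i - t j)\<close> does not depend on \<open>t0\<close>
  and whose right-hand side \<open>\<kappa> (t0 - t j)\<close> is continuous in \<open>t0\<close>. Positive definiteness makes the
  matrix injective, hence invertible, although it need not be symmetric. The weights are therefore
  unique, and each of them is a fixed linear combination of the continuous functions
  \<open>t0 \<mapsto> \<kappa> (t0 - t j)\<close>.

  The substance is that the system really has these entries. A covariation is a functional of two
  random variables, computed from integrands that represent them, so it equals
  \<open>\<integral> f (u - x) signed_powr (f (v - x)) (\<alpha> - 1) dx\<close> only because the integrand is determined almost everywhere by
  the integral (\<open>stable_integrand_unique\<close>); translation of the variable then gives \<open>\<kappa> (u - v)\<close>
  (\<open>moving_average_covariation\<close>).

  The integrand is recovered through characteristic functions. If \<open>s\<close> and \<open>s'\<close> are simple, the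
  difference of their integrals is almost surely a combination of the independent values of \<open>M\<close> on
  the common level sets of \<open>s\<close> and \<open>s'\<close>, so its characteristic function at \<open>1\<close> has modulus
  \<open>exp (- \<integral> \<bar>s - s'\<bar>\<^sup>\<alpha> dm)\<close> (\<open>norm_char_simple_stable_integral_diff\<close>); the skewness only affects the
  phase. If two approximating sequences have integrals with the same limit in probability, the
  differences tend to \<open>0\<close> in probability, this modulus tends to \<open>1\<close>, and the two sequences have the
  same limit in \<open>L\<^sup>\<alpha>\<close>.
\<close>

section \<open>Stable integrals of simple functions\<close>

locale stable_measure = prob_space P for P :: "'w measure" +
  fixes M :: "'a set \<Rightarrow> 'w \<Rightarrow> real" and \<alpha> :: real and m :: "'a measure" and \<beta> :: "'a \<Rightarrow> real"
  assumes alpha_pos: "0 < \<alpha>"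
    and random_measure: "stable_random_measure P M \<alpha> m \<beta>"
begin

lemma measurable_random_measure [measurable]:
  "A \<in> finite_measure_sets m \<Longrightarrow> M A \<in> borel_measurable P"
  using random_measure unfolding stable_random_measure_def has_stable_law_def by blast

lemma AE_sigma_additive:
  assumes "disjoint_family A" "range A \<subseteq> finite_measure_sets m" "(\<Union>i. A i) \<in> finite_measure_sets m"
  shows "AE \<omega> in P. (\<lambda>i::nat. M (A i) \<omega>) sums M (\<Union>i. A i) \<omega>"
  using random_measure assms unfolding stable_random_measure_def by blast

lemma indep_random_measure:
  assumes "disjoint_family_on A {..<k::nat}" "\<And>i. i < k \<Longrightarrow> A i \<in> finite_measure_sets m"
  shows "indep_vars (\<lambda>_. borel) (\<lambda>i. M (A i)) {..<k}"
  using random_measure assms unfolding stable_random_measure_def by blast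

lemma norm_char_random_measure:
  assumes "A \<in> finite_measure_sets m"
  shows "cmod (char (distr P borel (M A)) \<theta>) = exp (- (measure m A * \<bar>\<theta>\<bar> powr \<alpha>))"
proof -
  have "char (distr P borel (M A)) \<theta> =
      stable_char \<alpha> (measure m A powr (1 / \<alpha>)) ((LINT x:A|m. \<beta> x) / measure m A) 0 \<theta>"
    using random_measure assms unfolding stable_random_measure_def has_stable_law_def by blast
  then show ?thesis
    using alpha_pos by (simp add: stable_char_def norm_exp_eq_Re powr_powr)
qed

lemma finite_measure_sets_Un:
  assumes "A \<in> finite_measure_sets m" "B \<in> finite_measure_sets m"
  shows "A \<union> B \<in> finite_measure_sets m"
proof -
  have "emeasure m (A \<union> B) \<le> emeasure m A + emeasure m B"
    using assms by (intro emeasure_subadditive) (auto simp: finite_measure_sets_def)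
  also have "\<dots> < \<infinity>" using assms by (auto simp: finite_measure_sets_def)
  finally show ?thesis using assms by (auto simp: finite_measure_sets_def)
qed

lemma finite_measure_sets_empty: "{} \<in> finite_measure_sets m"
  by (simp add: finite_measure_sets_def)

lemma finite_measure_sets_UN:
  assumes "finite J" "\<And>c. c \<in> J \<Longrightarrow> A c \<in> finite_measure_sets m"
  shows "(\<Union>c\<in>J. A c) \<in> finite_measure_sets m"
  using assms by (induction J) (auto intro: finite_measure_sets_Un finite_measure_sets_empty)

text \<open>Sigma-additivity on the constant sequence of empty sets makes a constant series converge.\<close>

lemma AE_random_measure_empty: "AE \<omega> in P. M {} \<omega> = 0"
proof -
  have "AE \<omega> in P. (\<lambda>i::nat. M {} \<omega>) sums M (\<Union>i::nat. {}) \<omega>"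
    by (rule AE_sigma_additive) (auto simp: disjoint_family_on_def finite_measure_sets_empty)
  then show ?thesis
  proof eventually_elim
    case (elim \<omega>)
    then have "summable (\<lambda>i::nat. M {} \<omega>)" by (rule sums_summable)
    then show ?case by (simp add: summable_const_iff)
  qed
qed

lemma AE_random_measure_Un:
  assumes "A \<in> finite_measure_sets m" "B \<in> finite_measure_sets m" "A \<inter> B = {}"
  shows "AE \<omega> in P. M (A \<union> B) \<omega> = M A \<omega> + M B \<omega>"
proof -
  \<comment> \<open>padding with empty sets turns the pair into a sequence to which sigma-additivity applies\<close>
  define C where "C = (\<lambda>i::nat. if i = 0 then A else if i = 1 then B else {})"
  have U: "(\<Union>i. C i) = A \<union> B" by (force simp: C_def split: if_splits)
  have "AE \<omega> in P. (\<lambda>i. M (C i) \<omega>) sums M (\<Union>i. C i) \<omega>"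
    using assms finite_measure_sets_empty finite_measure_sets_Un[OF assms(1,2)]
    by (intro AE_sigma_additive) (unfold U, auto simp: C_def disjoint_family_on_def)
  with AE_random_measure_empty show ?thesis
  proof eventually_elim
    case (elim \<omega>)
    have "(\<lambda>i. M (C i) \<omega>) sums (\<Sum>i\<in>{0,1}. M (C i) \<omega>)"
      using elim(1) by (intro sums_finite) (auto simp: C_def)
    with elim(2) have "M (\<Union>i. C i) \<omega> = (\<Sum>i\<in>{0,1}. M (C i) \<omega>)" by (rule sums_unique2)
    then show ?case unfolding U by (simp add: C_def)
  qed
qed

lemma AE_random_measure_UN:
  assumes "finite J" "disjoint_family_on A J" "\<And>c. c \<in> J \<Longrightarrow> A c \<in> finite_measure_sets m"
  shows "AE \<omega> in P. M (\<Union>c\<in>J. A c) \<omega> = (\<Sum>c\<in>J. M (A c) \<omega>)"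
  using assms
proof (induction J)
  case empty
  then show ?case using AE_random_measure_empty by simp
next
  case (insert c J)
  have "AE \<omega> in P. M (A c \<union> (\<Union>c\<in>J. A c)) \<omega> = M (A c) \<omega> + M (\<Union>c\<in>J. A c) \<omega>"
    using insert by (intro AE_random_measure_Un finite_measure_sets_UN)
      (auto simp: disjoint_family_on_def)
  moreover have "AE \<omega> in P. M (\<Union>c\<in>J. A c) \<omega> = (\<Sum>c\<in>J. M (A c) \<omega>)"
    using insert by (auto simp: disjoint_family_on_def)
  ultimately show ?case
    by eventually_elim (use insert.hyps in simp)
qed

text \<open>The integral of a simple function groups points by its values; here they are grouped by a finer
  label \<open>p\<close>, which lets two simple functions be integrated over one common partition. The label \<open>c0\<close>
  plays the part of the value \<open>0\<close>: its cell may have infinite measure, where \<open>M\<close> is not controlled,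
  and is left out.\<close>

lemma AE_simple_stable_integral_refine:
  fixes p :: "'a \<Rightarrow> 'c" and \<phi> :: "'c \<Rightarrow> real"
  assumes fin: "finite (p ` space m)" and zero: "\<phi> c0 = 0"
    and cells: "\<And>c. c \<in> p ` space m - {c0} \<Longrightarrow> {x \<in> space m. p x = c} \<in> finite_measure_sets m"
  shows "AE \<omega> in P. simple_stable_integral M m (\<lambda>x. \<phi> (p x)) \<omega> =
    (\<Sum>c\<in>p ` space m - {c0}. \<phi> c * M {x \<in> space m. p x = c} \<omega>)"
proof -
  let ?J = "p ` space m - {c0}" and ?cell = "\<lambda>c. {x \<in> space m. p x = c}"
  let ?Y = "(\<lambda>x. \<phi> (p x)) ` space m - {0}"
  have finY: "finite ?Y"
    using finite_imageI[OF fin, of \<phi>] by (simp add: image_image)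
  have "AE \<omega> in P. M {x \<in> space m. \<phi> (p x) = y} \<omega> = (\<Sum>c\<in>{c\<in>?J. \<phi> c = y}. M (?cell c) \<omega>)"
    if y: "y \<in> ?Y" for y
  proof -
    have "{x \<in> space m. \<phi> (p x) = y} = (\<Union>c\<in>{c\<in>?J. \<phi> c = y}. ?cell c)"
      using y zero by auto
    then show ?thesis
      using fin cells AE_random_measure_UN[of "{c\<in>?J. \<phi> c = y}" ?cell]
      by (auto simp: disjoint_family_on_def)
  qed
  then have "AE \<omega> in P. \<forall>y\<in>?Y. M {x \<in> space m. \<phi> (p x) = y} \<omega> =
      (\<Sum>c\<in>{c\<in>?J. \<phi> c = y}. M (?cell c) \<omega>)"
    using finY by (intro AE_finite_allI)
  then show ?thesis
  proof eventually_elim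
    case (elim \<omega>)
    have "simple_stable_integral M m (\<lambda>x. \<phi> (p x)) \<omega> =
        (\<Sum>y\<in>?Y. y * (\<Sum>c\<in>{c\<in>?J. \<phi> c = y}. M (?cell c) \<omega>))"
      unfolding simple_stable_integral_def using elim by (intro sum.cong) auto
    also have "\<dots> = (\<Sum>y\<in>?Y. \<Sum>c\<in>{c\<in>{c\<in>?J. \<phi> c \<noteq> 0}. \<phi> c = y}. \<phi> c * M (?cell c) \<omega>)"
      by (intro sum.cong refl) (auto simp: sum_distrib_left intro!: sum.cong)
    also have "\<dots> = (\<Sum>c\<in>{c\<in>?J. \<phi> c \<noteq> 0}. \<phi> c * M (?cell c) \<omega>)"
      using fin finY by (intro sum.group) auto
    also have "\<dots> = (\<Sum>c\<in>?J. \<phi> c * M (?cell c) \<omega>)"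
      using fin by (intro sum.mono_neutral_left) auto
    finally show ?case .
  qed
qed

text \<open>Independence turns the characteristic function of the sum into a product, and the modulus of
  each factor is free of the skewness.\<close>

lemma norm_char_sum_random_measure:
  fixes A :: "'c \<Rightarrow> 'a set" and a :: "'c \<Rightarrow> real"
  assumes J: "finite J" and disj: "disjoint_family_on A J"
    and A: "\<And>c. c \<in> J \<Longrightarrow> A c \<in> finite_measure_sets m"
  shows "cmod (LINT \<omega>|P. iexp (\<Sum>c\<in>J. a c * M (A c) \<omega>)) =
    exp (- (\<Sum>c\<in>J. \<bar>a c\<bar> powr \<alpha> * measure m (A c)))"
proof -
  obtain h where h: "bij_betw h {..<card J} J"
    using ex_bij_betw_nat_finite[OF J] by (auto simp: atLeast0LessThan)
  let ?n = "card J"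
  let ?Y = "\<lambda>i \<omega>. a (h i) * M (A (h i)) \<omega>"
  have hJ: "h i \<in> J" if "i < ?n" for i using h that by (auto simp: bij_betw_def)
  have "disjoint_family_on (\<lambda>i. A (h i)) {..<?n}"
    using disj hJ bij_betw_imp_inj_on[OF h] unfolding disjoint_family_on_def
    by (metis inj_onD lessThan_iff)
  then have "indep_vars (\<lambda>_. borel) (\<lambda>i. M (A (h i))) {..<?n}"
    using A hJ by (intro indep_random_measure) auto
  then have indep: "indep_vars (\<lambda>_. borel) ?Y {..<?n}"
    by (rule indep_vars_compose2) auto
  have Y[measurable]: "?Y i \<in> borel_measurable P" if "i < ?n" for i
    using A[OF hJ[OF that]] by measurable
  have each: "cmod (char (distr P borel (?Y i)) 1) =
      exp (- (\<bar>a (h i)\<bar> powr \<alpha> * measure m (A (h i))))" if i: "i < ?n" for i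
  proof -
    have [measurable]: "M (A (h i)) \<in> borel_measurable P" using A[OF hJ[OF i]] by measurable
    have "char (distr P borel (?Y i)) 1 = char (distr P borel (M (A (h i)))) (a (h i))"
      by (simp add: char_def integral_distr)
    then show ?thesis
      using norm_char_random_measure[OF A[OF hJ[OF i]]] by (simp add: mult.commute)
  qed
  have "(LINT \<omega>|P. iexp (\<Sum>c\<in>J. a c * M (A c) \<omega>)) = (LINT \<omega>|P. iexp (\<Sum>i<?n. ?Y i \<omega>))"
    by (simp add: sum.reindex_bij_betw[OF h, of "\<lambda>c. a c * M (A c) _", symmetric] del: of_real_sum)
  also have "\<dots> = char (distr P borel (\<lambda>\<omega>. \<Sum>i<?n. ?Y i \<omega>)) 1"
    using Y by (simp add: char_def integral_distr del: of_real_sum)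
  also have "\<dots> = (\<Prod>i<?n. char (distr P borel (?Y i)) 1)"
    by (rule char_distr_sum[OF indep])
  finally have "cmod (LINT \<omega>|P. iexp (\<Sum>c\<in>J. a c * M (A c) \<omega>)) =
      (\<Prod>i<?n. exp (- (\<bar>a (h i)\<bar> powr \<alpha> * measure m (A (h i)))))"
    using each by (simp add: prod_norm[symmetric])
  also have "\<dots> = exp (- (\<Sum>i<?n. \<bar>a (h i)\<bar> powr \<alpha> * measure m (A (h i))))"
    by (simp add: exp_sum[symmetric] sum_negf)
  also have "\<dots> = exp (- (\<Sum>c\<in>J. \<bar>a c\<bar> powr \<alpha> * measure m (A c)))"
    by (simp add: sum.reindex_bij_betw[OF h, of "\<lambda>c. \<bar>a c\<bar> powr \<alpha> * measure m (A c)"])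
  finally show ?thesis .
qed

lemma simple_bochner_integrable_level_set:
  assumes "Bochner_Integration.simple_bochner_integrable m s" "y \<noteq> 0"
  shows "{x \<in> space m. s x = y} \<in> finite_measure_sets m"
proof -
  have s: "simple_function m s" "emeasure m {x \<in> space m. s x \<noteq> 0} \<noteq> \<infinity>"
    using assms(1) by (auto elim: Bochner_Integration.simple_bochner_integrable.cases)
  have "{x \<in> space m. s x \<noteq> 0} \<in> sets m" "{x \<in> space m. s x = y} \<in> sets m"
    using s(1) by (auto intro: simple_functionD)
  moreover from this have "emeasure m {x \<in> space m. s x = y} \<le> emeasure m {x \<in> space m. s x \<noteq> 0}"
    using assms(2) by (intro emeasure_mono) auto
  ultimately show ?thesis
    using s(2) by (auto simp: finite_measure_sets_def less_top top_unique)
qed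

lemma measurable_simple_stable_integral [measurable]:
  assumes "Bochner_Integration.simple_bochner_integrable m s"
  shows "simple_stable_integral M m s \<in> borel_measurable P"
  unfolding simple_stable_integral_def
  using simple_bochner_integrable_level_set[OF assms]
  by (intro borel_measurable_sum borel_measurable_times) auto

text \<open>The modulus of the characteristic function sees exactly the \<open>L\<^sup>\<alpha>\<close> distance of the integrands.
  This is the quantitative link between the random variables and their integrands.\<close>

lemma norm_char_simple_stable_integral_diff:
  assumes s: "Bochner_Integration.simple_bochner_integrable m s" and s': "Bochner_Integration.simple_bochner_integrable m s'"
  shows "cmod (LINT \<omega>|P. iexp (simple_stable_integral M m s \<omega> - simple_stable_integral M m s' \<omega>)) =
    exp (- (LINT x|m. \<bar>s x - s' x\<bar> powr \<alpha>))"
proof -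
  let ?p = "\<lambda>x. (s x, s' x)"
  let ?J = "?p ` space m - {(0, 0)}" and ?cell = "\<lambda>c. {x \<in> space m. ?p x = c}"
  have sf: "simple_function m s" "simple_function m s'"
    using s s' by (auto elim: Bochner_Integration.simple_bochner_integrable.cases)
  then have p: "simple_function m ?p" by (rule simple_function_Pair)
  then have fin: "finite (?p ` space m)" by (rule simple_functionD)
  have cells: "?cell c \<in> finite_measure_sets m" if "c \<in> ?J" for c
  proof -
    have "?cell c \<in> sets m" using simple_functionD(2)[OF p, of "{c}"]
      by (simp add: vimage_def Int_def conj_commute)
    moreover obtain B where "B \<in> finite_measure_sets m" "?cell c \<subseteq> B"
    proof (cases "fst c = 0")
      case False
      then show thesis
        using simple_bochner_integrable_level_set[OF s] by (intro that[of "{x \<in> space m. s x = fst c}"]) auto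
    next
      case True
      with \<open>c \<in> ?J\<close> have "snd c \<noteq> 0" by (auto simp: prod_eq_iff)
      then show thesis
        using simple_bochner_integrable_level_set[OF s'] by (intro that[of "{x \<in> space m. s' x = snd c}"]) auto
    qed
    \<comment> \<open>off the cell of \<open>(0, 0)\<close> one of the two functions is nonzero, and its level set bounds the cell\<close>
    ultimately show ?thesis
      using emeasure_mono[of "?cell c" B m] by (auto simp: finite_measure_sets_def)
  qed
  have "AE \<omega> in P. simple_stable_integral M m s \<omega> = (\<Sum>c\<in>?J. fst c * M (?cell c) \<omega>)"
    using AE_simple_stable_integral_refine[OF fin _ cells, of fst] by simp
  moreover have "AE \<omega> in P. simple_stable_integral M m s' \<omega> = (\<Sum>c\<in>?J. snd c * M (?cell c) \<omega>)"
    using AE_simple_stable_integral_refine[OF fin _ cells, of snd] by simp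
  ultimately have "AE \<omega> in P. simple_stable_integral M m s \<omega> - simple_stable_integral M m s' \<omega> =
      (\<Sum>c\<in>?J. (fst c - snd c) * M (?cell c) \<omega>)"
    by eventually_elim (simp add: left_diff_distrib sum_subtractf)
  moreover have "(\<lambda>\<omega>. \<Sum>c\<in>?J. (fst c - snd c) * M (?cell c) \<omega>) \<in> borel_measurable P"
    using cells by (intro borel_measurable_sum borel_measurable_times) auto
  ultimately have "(LINT \<omega>|P. iexp (simple_stable_integral M m s \<omega> - simple_stable_integral M m s' \<omega>)) =
      (LINT \<omega>|P. iexp (\<Sum>c\<in>?J. (fst c - snd c) * M (?cell c) \<omega>))"
    using s s' by (intro integral_cong_AE) (auto simp del: of_real_sum of_real_diff)
  also have "cmod \<dots> = exp (- (\<Sum>c\<in>?J. \<bar>fst c - snd c\<bar> powr \<alpha> * measure m (?cell c)))"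
    using fin cells by (intro norm_char_sum_random_measure) (auto simp: disjoint_family_on_def)
  also have "(\<Sum>c\<in>?J. \<bar>fst c - snd c\<bar> powr \<alpha> * measure m (?cell c)) =
      (\<Sum>c\<in>?J. (LINT x|m. \<bar>fst c - snd c\<bar> powr \<alpha> * indicator (?cell c) x))"
    using cells by (intro sum.cong refl) (simp add: finite_measure_sets_def Int_absorb2 subset_eq)
  also have "\<dots> = (LINT x|m. (\<Sum>c\<in>?J. \<bar>fst c - snd c\<bar> powr \<alpha> * indicator (?cell c) x))"
    using cells by (intro Bochner_Integration.integral_sum[symmetric])
      (auto simp: finite_measure_sets_def)
  also have "\<dots> = (LINT x|m. \<bar>s x - s' x\<bar> powr \<alpha>)"
  proof (intro Bochner_Integration.integral_cong refl)
    fix x assume x: "x \<in> space m"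
    have "(\<Sum>c\<in>?J. \<bar>fst c - snd c\<bar> powr \<alpha> * indicator (?cell c) x) =
        (\<Sum>c\<in>?J. if c = ?p x then \<bar>fst c - snd c\<bar> powr \<alpha> else 0)"
      using x by (intro sum.cong refl) (auto simp: indicator_def)
    also have "\<dots> = \<bar>s x - s' x\<bar> powr \<alpha>"
      using fin x by (subst sum.delta) auto
    finally show "(\<Sum>c\<in>?J. \<bar>fst c - snd c\<bar> powr \<alpha> * indicator (?cell c) x) = \<bar>s x - s' x\<bar> powr \<alpha>" .
  qed
  finally show ?thesis .
qed

end

section \<open>The integrand is determined by the integral\<close>

text \<open>For \<open>p < 1\<close> the \<open>p\<close>-th power norm has no triangle inequality; this weak form holds for all
  \<open>p \<ge> 0\<close> and suffices for limits.\<close>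

lemma powr_abs_diff_le:
  fixes a b :: real
  assumes "0 \<le> p"
  shows "\<bar>a - b\<bar> powr p \<le> 2 powr p * (\<bar>a\<bar> powr p + \<bar>b\<bar> powr p)"
proof -
  have "\<bar>a - b\<bar> powr p \<le> (2 * max \<bar>a\<bar> \<bar>b\<bar>) powr p"
    using assms by (intro powr_mono2) auto
  also have "\<dots> = 2 powr p * max \<bar>a\<bar> \<bar>b\<bar> powr p"
    by (simp add: powr_mult)
  also have "\<dots> \<le> 2 powr p * (\<bar>a\<bar> powr p + \<bar>b\<bar> powr p)"
    by (intro mult_left_mono) (auto simp: max_def)
  finally show ?thesis .
qed

lemma
  fixes u v :: "'a \<Rightarrow> real"
  assumes "0 \<le> p"
    and [measurable]: "u \<in> borel_measurable m" "v \<in> borel_measurable m"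
    and u: "integrable m (\<lambda>x. \<bar>u x\<bar> powr p)" and v: "integrable m (\<lambda>x. \<bar>v x\<bar> powr p)"
  shows integrable_powr_abs_diff: "integrable m (\<lambda>x. \<bar>u x - v x\<bar> powr p)"
    and integral_powr_abs_diff_le: "(LINT x|m. \<bar>u x - v x\<bar> powr p) \<le>
      2 powr p * ((LINT x|m. \<bar>u x\<bar> powr p) + (LINT x|m. \<bar>v x\<bar> powr p))"
proof -
  have bound: "integrable m (\<lambda>x. 2 powr p * (\<bar>u x\<bar> powr p + \<bar>v x\<bar> powr p))"
    using u v by auto
  show *: "integrable m (\<lambda>x. \<bar>u x - v x\<bar> powr p)"
    by (rule Bochner_Integration.integrable_bound[OF bound])
      (use powr_abs_diff_le[OF \<open>0 \<le> p\<close>] in auto)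
  have "(LINT x|m. \<bar>u x - v x\<bar> powr p) \<le> (LINT x|m. 2 powr p * (\<bar>u x\<bar> powr p + \<bar>v x\<bar> powr p))"
    by (intro integral_mono * bound powr_abs_diff_le[OF \<open>0 \<le> p\<close>])
  then show "(LINT x|m. \<bar>u x - v x\<bar> powr p) \<le>
      2 powr p * ((LINT x|m. \<bar>u x\<bar> powr p) + (LINT x|m. \<bar>v x\<bar> powr p))"
    using u v by simp
qed

text \<open>The integrand \<open>iexp W - 1\<close> has modulus at most \<open>\<bar>W\<bar>\<close>, used where \<open>\<bar>W\<bar> \<le> \<epsilon>\<close>, and at most \<open>2\<close>, used
  elsewhere.\<close>

lemma (in prob_space) norm_char_minus_one_le:
  assumes [measurable]: "W \<in> borel_measurable M" and "0 \<le> \<epsilon>"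
  shows "cmod ((LINT \<omega>|M. iexp (W \<omega>)) - 1) \<le> \<epsilon> + 2 * prob {\<omega> \<in> space M. \<bar>W \<omega>\<bar> > \<epsilon>}"
proof -
  have int: "integrable M (\<lambda>\<omega>. iexp (W \<omega>))" by (rule integrable_iexp) auto
  have "(LINT \<omega>|M. iexp (W \<omega>)) - 1 = (LINT \<omega>|M. iexp (W \<omega>) - 1)"
    using int by (simp add: prob_space)
  also have "cmod \<dots> \<le> (LINT \<omega>|M. cmod (iexp (W \<omega>) - 1))"
    by (rule integral_norm_bound)
  also have "\<dots> \<le> (LINT \<omega>|M. \<epsilon> + 2 * indicator {\<omega> \<in> space M. \<bar>W \<omega>\<bar> > \<epsilon>} \<omega>)"
  proof (rule integral_mono)
    show "integrable M (\<lambda>\<omega>. cmod (iexp (W \<omega>) - 1))" using int by auto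
    show "integrable M (\<lambda>\<omega>. \<epsilon> + 2 * indicator {\<omega> \<in> space M. \<bar>W \<omega>\<bar> > \<epsilon>} \<omega>)"
      by (auto simp: finite_measure_restricted less_top[symmetric])
    fix \<omega> assume \<omega>: "\<omega> \<in> space M"
    have "cmod (iexp (W \<omega>) - 1) \<le> \<bar>W \<omega>\<bar>"
      using iexp_approx1[of "W \<omega>" 0] by simp
    moreover have "cmod (iexp (W \<omega>) - 1) \<le> cmod (iexp (W \<omega>)) + cmod 1"
      by (rule norm_triangle_ineq4)
    ultimately show "cmod (iexp (W \<omega>) - 1) \<le> \<epsilon> + 2 * indicator {\<omega> \<in> space M. \<bar>W \<omega>\<bar> > \<epsilon>} \<omega>"
      using \<omega> \<open>0 \<le> \<epsilon>\<close> by (auto simp: indicator_def)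
  qed
  also have "\<dots> = \<epsilon> + 2 * prob {\<omega> \<in> space M. \<bar>W \<omega>\<bar> > \<epsilon>}"
    by (subst Bochner_Integration.integral_add)
      (auto simp: prob_space finite_measure_restricted less_top[symmetric] intro!: arg_cong[of _ _ prob])
  finally show ?thesis .
qed

lemma (in prob_space) tendsto_char_diff_common_limit:
  assumes meas: "\<And>k. Y k \<in> borel_measurable M" "\<And>k. Z k \<in> borel_measurable M" "U \<in> borel_measurable M"
    and Y: "tendsto_in_prob M Y U" and Z: "tendsto_in_prob M Z U"
  shows "(\<lambda>k. LINT \<omega>|M. iexp (Y k \<omega> - Z k \<omega>)) \<longlonglongrightarrow> 1"
proof (rule tendstoI)
  note [measurable] = meas
  fix \<epsilon> :: real assume "0 < \<epsilon>"
  \<comment> \<open>each of \<open>Y k - U\<close>, \<open>Z k - U\<close> may contribute \<open>\<delta>\<close>, so the expectation is at most about \<open>2 \<delta> < \<epsilon>\<close>\<close>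
  define \<delta> where "\<delta> = \<epsilon> / 4"
  have "0 < \<delta>" using \<open>0 < \<epsilon>\<close> by (simp add: \<delta>_def)
  let ?b = "\<lambda>k. \<delta> * 2 + 2 * (prob {\<omega> \<in> space M. \<bar>Y k \<omega> - U \<omega>\<bar> > \<delta>} + prob {\<omega> \<in> space M. \<bar>Z k \<omega> - U \<omega>\<bar> > \<delta>})"
  have "?b \<longlonglongrightarrow> \<delta> * 2 + 2 * (0 + 0)"
    using Y Z \<open>0 < \<delta>\<close> unfolding tendsto_in_prob_def by (intro tendsto_intros) auto
  moreover have "\<delta> * 2 + 2 * (0 + 0) < \<epsilon>" using \<open>0 < \<epsilon>\<close> by (simp add: \<delta>_def)
  ultimately have "\<forall>\<^sub>F k in sequentially. ?b k < \<epsilon>" by (rule order_tendstoD)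
  then show "\<forall>\<^sub>F k in sequentially. dist (LINT \<omega>|M. iexp (Y k \<omega> - Z k \<omega>)) 1 < \<epsilon>"
  proof eventually_elim
    case (elim k)
    have "prob {\<omega> \<in> space M. \<bar>Y k \<omega> - Z k \<omega>\<bar> > \<delta> * 2} \<le>
        prob ({\<omega> \<in> space M. \<bar>Y k \<omega> - U \<omega>\<bar> > \<delta>} \<union> {\<omega> \<in> space M. \<bar>Z k \<omega> - U \<omega>\<bar> > \<delta>})"
      by (intro finite_measure_mono) auto
    also have "\<dots> \<le> prob {\<omega> \<in> space M. \<bar>Y k \<omega> - U \<omega>\<bar> > \<delta>} + prob {\<omega> \<in> space M. \<bar>Z k \<omega> - U \<omega>\<bar> > \<delta>}"
      by (intro measure_Un_le) auto
    finally show ?case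
      using norm_char_minus_one_le[of "\<lambda>\<omega>. Y k \<omega> - Z k \<omega>" "\<delta> * 2"] elim \<open>0 < \<delta>\<close>
      by (simp add: dist_norm)
  qed
qed

context stable_measure
begin

text \<open>The approximating sequences \<open>s\<close> of \<open>g\<close> and \<open>s'\<close> of \<open>g'\<close> are independent choices, so nothing
  relates them but the common limit \<open>U\<close> of their integrals. That limit forces the characteristic
  functions of the differences to \<open>1\<close> and hence \<open>\<integral> \<bar>s k - s' k\<bar>\<^sup>\<alpha> dm\<close> to \<open>0\<close>.\<close>

lemma stable_integrand_unique:
  assumes "has_stable_integral P M \<alpha> m g U" "has_stable_integral P M \<alpha> m g' U"
  shows "AE x in m. g x = g' x"
proof -
  from assms(1) obtain s where
    g[measurable]: "g \<in> borel_measurable m" and g_int: "integrable m (\<lambda>x. \<bar>g x\<bar> powr \<alpha>)"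
    and U: "U \<in> borel_measurable P"
    and s: "\<And>k. Bochner_Integration.simple_bochner_integrable m (s k)"
    and s_lim: "(\<lambda>k. LINT x|m. \<bar>s k x - g x\<bar> powr \<alpha>) \<longlonglongrightarrow> 0"
    and s_prob: "tendsto_in_prob P (\<lambda>k. simple_stable_integral M m (s k)) U"
    unfolding has_stable_integral_def L_alpha_def by auto
  from assms(2) obtain s' where
    g'[measurable]: "g' \<in> borel_measurable m" and g'_int: "integrable m (\<lambda>x. \<bar>g' x\<bar> powr \<alpha>)"
    and s': "\<And>k. Bochner_Integration.simple_bochner_integrable m (s' k)"
    and s'_lim: "(\<lambda>k. LINT x|m. \<bar>s' k x - g' x\<bar> powr \<alpha>) \<longlonglongrightarrow> 0"
    and s'_prob: "tendsto_in_prob P (\<lambda>k. simple_stable_integral M m (s' k)) U"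
    unfolding has_stable_integral_def L_alpha_def by auto
  have [measurable]: "s k \<in> borel_measurable m" "s' k \<in> borel_measurable m" for k
    using s[of k] s'[of k]
    by (auto elim!: Bochner_Integration.simple_bochner_integrable.cases intro: borel_measurable_simple_function)
  have simple_int: "integrable m (\<lambda>x. \<bar>r x\<bar> powr \<alpha>)"
    if "Bochner_Integration.simple_bochner_integrable m r" for r :: "'a \<Rightarrow> real"
    using simple_bochner_integrable_compose2[of "\<lambda>a _. \<bar>a\<bar> powr \<alpha>", OF _ that that]
    by (auto intro!: integrable.intros has_bochner_integral_simple_bochner_integrable)
  let ?D = "\<lambda>u v. LINT x|m. \<bar>u x - v x\<bar> powr \<alpha>"
  have "(\<lambda>k. cmod (LINT \<omega>|P. iexp (simple_stable_integral M m (s k) \<omega> - simple_stable_integral M m (s' k) \<omega>)))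
      \<longlonglongrightarrow> cmod 1"
    using s s' U s_prob s'_prob by (intro tendsto_norm tendsto_char_diff_common_limit) auto
  then have "(\<lambda>k. exp (- ?D (s k) (s' k))) \<longlonglongrightarrow> 1"
    by (simp add: norm_char_simple_stable_integral_diff[OF s s'] del: of_real_diff)
  then have "(\<lambda>k. - ln (exp (- ?D (s k) (s' k)))) \<longlonglongrightarrow> - ln 1"
    by (intro tendsto_intros) auto
  then have D_lim: "(\<lambda>k. ?D (s k) (s' k)) \<longlonglongrightarrow> 0" by simp
  let ?C = "2 powr \<alpha>"
  \<comment> \<open>two weak triangle inequalities along \<open>g\<close>, \<open>s k\<close>, \<open>s' k\<close>, \<open>g'\<close>\<close>
  have bound: "?D g g' \<le> ?C * (?C * (?D (s k) (s' k) + ?D (s k) g) + ?D (s' k) g')" for k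
  proof -
    note diff_int = integrable_powr_abs_diff[OF less_imp_le[OF alpha_pos]]
    note diff_le = integral_powr_abs_diff_le[OF less_imp_le[OF alpha_pos]]
    have "?D (\<lambda>x. s k x - s' k x) (\<lambda>x. s k x - g x) \<le> ?C * (?D (s k) (s' k) + ?D (s k) g)"
      using simple_int[OF s] simple_int[OF s'] g_int by (intro diff_le diff_int) auto
    then have 1: "?D g (s' k) \<le> ?C * (?D (s k) (s' k) + ?D (s k) g)" by simp
    have "?D (\<lambda>x. g x - s' k x) (\<lambda>x. g' x - s' k x) \<le> ?C * (?D g (s' k) + ?D g' (s' k))"
      using simple_int[OF s'] g_int g'_int by (intro diff_le diff_int) auto
    then have 2: "?D g g' \<le> ?C * (?D g (s' k) + ?D (s' k) g')" by (simp add: abs_minus_commute)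
    have "?C * (?D g (s' k) + ?D (s' k) g') \<le> ?C * (?C * (?D (s k) (s' k) + ?D (s k) g) + ?D (s' k) g')"
      using 1 by (intro mult_left_mono add_right_mono) auto
    with 2 show ?thesis by linarith
  qed
  have "(\<lambda>k. ?C * (?C * (?D (s k) (s' k) + ?D (s k) g) + ?D (s' k) g')) \<longlonglongrightarrow>
      ?C * (?C * (0 + 0) + 0)"
    using D_lim s_lim s'_lim by (intro tendsto_intros)
  then have "?D g g' \<le> ?C * (?C * (0 + 0) + 0)"
    by (rule LIMSEQ_le_const) (use bound in auto)
  then have "?D g g' = 0"
    by (intro antisym integral_nonneg_AE) auto
  then have "AE x in m. \<bar>g x - g' x\<bar> powr \<alpha> = 0"
    using integral_nonneg_eq_0_iff_AE[of m "\<lambda>x. \<bar>g x - g' x\<bar> powr \<alpha>"]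
      integrable_powr_abs_diff[OF less_imp_le[OF alpha_pos] g g' g_int g'_int] by auto
  then show ?thesis by eventually_elim simp
qed

text \<open>Almost everywhere equal integrands give the same integral, so the description that defines the
  covariation is satisfied by exactly one number.\<close>

lemma covariation_eq_integral:
  assumes g: "has_stable_integral P M \<alpha> m g U" and h: "has_stable_integral P M \<alpha> m h V"
  shows "covariation P M \<alpha> m U V = (LINT x|m. g x * signed_powr (h x) (\<alpha> - 1))"
  unfolding covariation_def
proof (rule the_equality)
  show "\<exists>g' h'. has_stable_integral P M \<alpha> m g' U \<and> has_stable_integral P M \<alpha> m h' V \<and>
      (LINT x|m. g x * signed_powr (h x) (\<alpha> - 1)) = (LINT x|m. g' x * signed_powr (h' x) (\<alpha> - 1))"
    using g h by blast
  fix c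
  assume "\<exists>g h. has_stable_integral P M \<alpha> m g U \<and> has_stable_integral P M \<alpha> m h V \<and>
      c = (LINT x|m. g x * signed_powr (h x) (\<alpha> - 1))"
  then obtain g' h' where
    g': "has_stable_integral P M \<alpha> m g' U" and h': "has_stable_integral P M \<alpha> m h' V"
    and c: "c = (LINT x|m. g' x * signed_powr (h' x) (\<alpha> - 1))" by blast
  have [measurable]: "g \<in> borel_measurable m" "h \<in> borel_measurable m"
    "g' \<in> borel_measurable m" "h' \<in> borel_measurable m"
    using g h g' h' by (auto simp: has_stable_integral_def L_alpha_def)
  show "c = (LINT x|m. g x * signed_powr (h x) (\<alpha> - 1))"
    unfolding c
  proof (rule integral_cong_AE)
    show "AE x in m. g' x * signed_powr (h' x) (\<alpha> - 1) = g x * signed_powr (h x) (\<alpha> - 1)"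
      using stable_integrand_unique[OF g' g] stable_integrand_unique[OF h' h]
      by eventually_elim simp
  qed (simp_all add: signed_powr_def)
qed

end

section \<open>The covariation of a moving average\<close>

lemma lborel_integral_translate:
  fixes f :: "'v::euclidean_space \<Rightarrow> real"
  assumes "f \<in> borel_measurable borel"
  shows "(LINT x|lborel. f (c + x)) = (LINT x|lborel. f x)"
  using integral_distr[of "(+) c" lborel borel f] assms by (simp add: lborel_distr_plus)

text \<open>Substituting \<open>v + x\<close> for \<open>x\<close> turns the integrands of \<open>X u\<close> and \<open>X v\<close> into those of \<open>X (u - v)\<close>
  and \<open>X 0\<close>.\<close>

lemma moving_average_covariation:
  fixes M :: "'v::euclidean_space set \<Rightarrow> 'w \<Rightarrow> real"
  assumes P: "prob_space P" and \<alpha>: "0 < \<alpha>"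
    and M: "stable_random_measure P M \<alpha> lborel \<beta>"
    and f[measurable]: "f \<in> borel_measurable borel"
    and X: "moving_average P M \<alpha> f X"
  shows "covariation P M \<alpha> lborel (X u) (X v) = covariation_function P M \<alpha> X (u - v)"
proof -
  interpret stable_measure P M \<alpha> lborel \<beta>
    using P \<alpha> M by (simp add: stable_measure_def stable_measure_axioms_def)
  have X: "has_stable_integral P M \<alpha> lborel (\<lambda>x. f (r - x)) (X r)" for r
    using X by (simp add: moving_average_def)
  have cov: "covariation P M \<alpha> lborel (X r) (X r') =
      (LINT x|lborel. f (r - x) * signed_powr (f (r' - x)) (\<alpha> - 1))" for r r'
    by (rule covariation_eq_integral[OF X X])
  have "covariation P M \<alpha> lborel (X u) (X v) =
      (LINT x|lborel. f (u - (v + x)) * signed_powr (f (v - (v + x))) (\<alpha> - 1))"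
    unfolding cov by (rule lborel_integral_translate[symmetric]) (simp add: signed_powr_def)
  then show ?thesis
    unfolding covariation_function_def cov by (simp add: diff_diff_eq)
qed

section \<open>Solving the system for the weights\<close>

lemma positive_definite_family:
  fixes t :: "'n::finite \<Rightarrow> 'v::real_vector"
  assumes \<kappa>: "positive_definite \<kappa>" and "inj t" and "\<exists>i. z i \<noteq> 0"
  shows "(\<Sum>i\<in>UNIV. \<Sum>j\<in>UNIV. \<kappa> (t i - t j) * z i * z j) > 0"
proof -
  obtain b where b: "bij_betw b {1..CARD('n)} (UNIV :: 'n set)"
    using ex_bij_betw_nat_finite_1[of "UNIV :: 'n set"] by auto
  have "inj_on (\<lambda>k. t (b k)) {1..CARD('n)}"
    using comp_inj_on[OF bij_betw_imp_inj_on[OF b], of t] \<open>inj t\<close>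
    by (simp add: o_def inj_on_subset)
  moreover have "\<exists>k\<in>{1..CARD('n)}. z (b k) \<noteq> 0"
    using b \<open>\<exists>i. z i \<noteq> 0\<close> unfolding bij_betw_def by (metis UNIV_I imageE)
  ultimately have "(\<Sum>k=1..CARD('n). \<Sum>l=1..CARD('n). \<kappa> (t (b k) - t (b l)) * z (b k) * z (b l)) > 0"
    using \<kappa>[unfolded positive_definite_def, rule_format, of "\<lambda>k. t (b k)" "CARD('n)" "\<lambda>k. z (b k)"]
    by blast
  also have "(\<Sum>k=1..CARD('n). \<Sum>l=1..CARD('n). \<kappa> (t (b k) - t (b l)) * z (b k) * z (b l)) =
      (\<Sum>k=1..CARD('n). \<Sum>j\<in>UNIV. \<kappa> (t (b k) - t j) * z (b k) * z j)"
    by (intro sum.cong refl sum.reindex_bij_betw[OF b])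
  also have "\<dots> = (\<Sum>i\<in>UNIV. \<Sum>j\<in>UNIV. \<kappa> (t i - t j) * z i * z j)"
    by (rule sum.reindex_bij_betw[OF b])
  finally show ?thesis .
qed

lemma invertible_of_positive_quadratic_form:
  fixes A :: "real ^ 'n ^ 'n"
  assumes "\<And>z. z \<noteq> 0 \<Longrightarrow> z \<bullet> (A *v z) > 0"
  shows "invertible A"
proof -
  have "z = 0" if "A *v z = 0" for z
    using assms[of z] that by (cases "z = 0") auto
  then show ?thesis
    by (auto simp: invertible_left_inverse matrix_left_invertible_ker)
qed

theorem theorem13:
  fixes P :: "'w measure"
    and \<alpha> :: real
    and M :: "(real ^ 'd) set \<Rightarrow> 'w \<Rightarrow> real"
    and \<beta> :: "real ^ 'd \<Rightarrow> real"
    and f :: "real ^ 'd \<Rightarrow> real"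
    and X :: "real ^ 'd \<Rightarrow> 'w \<Rightarrow> real"
    and t :: "'n::finite \<Rightarrow> real ^ 'd"
  assumes "prob_space P"
    and "1 < \<alpha>" "\<alpha> \<le> 2"
    and "inj t"
    and "stable_random_measure P M \<alpha> lborel \<beta>"
    and "f \<in> borel_measurable borel"
    and "integrable lborel (\<lambda>x. \<bar>f x\<bar> powr \<alpha>)"
    and "moving_average P M \<alpha> f X"
    and "positive_definite (covariation_function P M \<alpha> X)"
    and "continuous_on UNIV (covariation_function P M \<alpha> X)"
  shows "(\<forall>t0. \<exists>!w. COL_weights P M \<alpha> X t t0 w) \<and>
         (\<forall>wt. (\<forall>t0. COL_weights P M \<alpha> X t t0 (wt t0)) \<longrightarrow>
               (\<forall>i. continuous_on UNIV (\<lambda>t0. wt t0 i)))"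
proof -
  let ?\<kappa> = "covariation_function P M \<alpha> X"
  define A :: "real ^ 'n ^ 'n" where "A = (\<chi> j i. ?\<kappa> (t i - t j))"
  define b :: "real ^ 'd \<Rightarrow> real ^ 'n" where "b = (\<lambda>t0. \<chi> j. ?\<kappa> (t0 - t j))"
  have "z \<bullet> (A *v z) > 0" if "z \<noteq> 0" for z :: "real ^ 'n"
  proof -
    have "z \<bullet> (A *v z) = (\<Sum>j\<in>UNIV. \<Sum>i\<in>UNIV. ?\<kappa> (t i - t j) * z $ i * z $ j)"
      by (simp add: A_def inner_vec_def matrix_vector_mult_def sum_distrib_left mult_ac)
    also have "\<dots> = (\<Sum>i\<in>UNIV. \<Sum>j\<in>UNIV. ?\<kappa> (t i - t j) * z $ i * z $ j)"
      by (rule sum.swap)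
    also have "\<dots> > 0"
      using that by (intro positive_definite_family assms) (simp add: vec_eq_iff)
    finally show ?thesis .
  qed
  then have "invertible A" by (rule invertible_of_positive_quadratic_form)
  then obtain B where B: "A ** B = mat 1" "B ** A = mat 1" by (auto simp: invertible_def)
  \<comment> \<open>row \<open>j\<close> of \<open>A\<close> is the equation for \<open>t j\<close>, so the weight index \<open>i\<close> runs over the columns\<close>
  have COL_iff: "COL_weights P M \<alpha> X t t0 w \<longleftrightarrow> (\<chi> i. w i) = B *v b t0" for t0 w
  proof -
    have cov: "covariation P M \<alpha> lborel (X u) (X v) = ?\<kappa> (u - v)" for u v
      using assms by (intro moving_average_covariation[where f = f and \<beta> = \<beta>]) auto
    have "COL_weights P M \<alpha> X t t0 w \<longleftrightarrow> A *v (\<chi> i. w i) = b t0"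
      by (auto simp: COL_weights_def cov A_def b_def vec_eq_iff matrix_vector_mult_def mult.commute)
    also have "\<dots> \<longleftrightarrow> (\<chi> i. w i) = B *v b t0"
      by (metis B matrix_vector_mul_assoc matrix_vector_mul_lid)
    finally show ?thesis .
  qed
  have "\<exists>!w. COL_weights P M \<alpha> X t t0 w" for t0
    unfolding COL_iff by (rule ex1I[of _ "\<lambda>i. (B *v b t0) $ i"]) (auto simp: vec_eq_iff)
  moreover have "continuous_on UNIV (\<lambda>t0. wt t0 i)"
    if wt: "\<forall>t0. COL_weights P M \<alpha> X t t0 (wt t0)" for wt i
  proof -
    have "wt t0 i = (\<Sum>j\<in>UNIV. B $ i $ j * ?\<kappa> (t0 - t j))" for t0
    proof -
      have "wt t0 i = (B *v b t0) $ i"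
        using wt unfolding COL_iff by (metis vec_lambda_beta)
      then show ?thesis by (simp add: matrix_vector_mult_def b_def)
    qed
    moreover have "continuous_on UNIV (\<lambda>t0. \<Sum>j\<in>UNIV. B $ i $ j * ?\<kappa> (t0 - t j))"
      by (intro continuous_intros continuous_on_compose2[OF assms(10)]) auto
    ultimately show ?thesis by simp
  qed
  ultimately show ?thesis by blast
qed

end
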